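(* For every integer $n \geq 1$, the number $Z_{T_0}(n)$ of $T_0$-topologies $\mathcal{T}$ on $\{1,\ldots,n\}$ with covering dimension $\dim(\{1,\ldots,n\},\mathcal{T}) = 0$ satisfies \[ Z_{T_0}(n) = \sum_{\mathcal{P} \in \mathrm{Part}(n)} \ \prod_{A \in \mathcal{P},\, |A|>1} |A|\cdot P(|A|-1), \] where $\mathrm{Part}(n)$ is the set of all partitions of $\{1,\ldots,n\}$ and $P(k)$ is the number of partial orders on $\{1,\ldots,k\}$ (an empty product equals $1$).
   Context: A topology $\mathcal{T}$ on $X$ is $T_0$ if for any two distinct points $x,y$ there is an open set containing exactly one of them. A finite open covering of $(X,\mathcal{T})$ is a finite subset $\mathcal{A}\subseteq\mathcal{T}$ with $\bigcup\mathcal{A}=X$; $\mathcal{A}$ is finer than $\mathcal{B}$ if every $A\in\mathcal{A}$ is contained in some $B\in\mathcal{B}$. The order of a finite open covering $\mathcal{A}$ is the largest integer $m\geq -1$ such that $\mathcal{A}$ contains $m+1$ distinct sets with non-empty intersection. For $m\geq -1$, $\dim(X,\mathcal{T})\leq m$ means every finite open covering has a finer finite open covering of order $\leq m$; $\dim(X,\mathcal{T})=0$ means $\dim(X,\mathcal{T})\leq 0$ but not $\dim(X,\mathcal{T})\leq -1$ (the latter holds exactly for the empty space). *)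

theory Defs
  imports "HOL-Analysis.Analysis" "HOL-Library.Disjoint_Sets"
begin

definition finite_open_cover :: "'a topology \<Rightarrow> 'a set set \<Rightarrow> bool" where
  "finite_open_cover X \<A> \<longleftrightarrow> finite \<A> \<and> (\<forall>U\<in>\<A>. openin X U) \<and> \<Union>\<A> = topspace X"

definition finer_cover :: "'a set set \<Rightarrow> 'a set set \<Rightarrow> bool" where
  "finer_cover \<A> \<B> \<longleftrightarrow> (\<forall>A\<in>\<A>. \<exists>B\<in>\<B>. A \<subseteq> B)"

(* The largest m >= -1 such that some m + 1 distinct members of the finite family have a
   common point.  The empty subfamily always qualifies, since \<Inter>{} = UNIV is nonempty; hence
   the set under Max is nonempty and the order is at least -1, also for the families {} and {{}}. *)
definition cover_order :: "'a set set \<Rightarrow> int" where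
  "cover_order \<A> = Max {int (card \<S>) - 1 | \<S>. \<S> \<subseteq> \<A> \<and> \<Inter>\<S> \<noteq> {}}"

(* Lebesgue covering dimension; this is not the inductive dimension dimension_le
   of HOL-Analysis. *)
definition covering_dim_le :: "'a topology \<Rightarrow> int \<Rightarrow> bool" where
  "covering_dim_le X m \<longleftrightarrow>
     (\<forall>\<B>. finite_open_cover X \<B> \<longrightarrow>
        (\<exists>\<A>. finite_open_cover X \<A> \<and> finer_cover \<A> \<B> \<and> cover_order \<A> \<le> m))"

definition covering_dim_zero :: "'a topology \<Rightarrow> bool" where
  "covering_dim_zero X \<longleftrightarrow> covering_dim_le X 0 \<and> \<not> covering_dim_le X (-1)"

definition num_partial_orders :: "nat \<Rightarrow> nat" where
  "num_partial_orders k = card {r. partial_order_on {1..k} r}"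

definition num_zero_dim_T0_topologies :: "nat \<Rightarrow> nat" where
  "num_zero_dim_T0_topologies n =
     card {X :: nat topology. topspace X = {1..n} \<and> t0_space X \<and> covering_dim_zero X}"

end

theory Submission
  imports Defs
begin

subsection \<open>Orders on finite sets\<close>

text \<open>On a finite set, T0 topologies are the same thing as partial orders: the open sets are
  the down-sets, and the smallest open set around \<open>y\<close> is the principal down-set of
  \<open>y\<close> (\<open>bij_betw_down_sets\<close>). Every element lies below some maximal
  element, so the principal down-sets of the maximal elements form an open cover that is finer than
  every other one. A cover has order at most 0 exactly when its members are pairwise disjoint. Hence
  the dimension is at most 0 iff no element lies below two maximal elements
  (\<open>covering_dim_le_0_down_sets_iff\<close>), and dimension -1 is excluded because the space
  is nonempty.

  Such an order is a disjoint union of orders with a greatest element, one on each block of a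
  partition, and the partition and the block orders can be read off from it
  (\<open>unique_maximal_glue\<close>, \<open>unique_maximal_split\<close>). An order with greatest
  element on a block \<open>A\<close> is a choice of that element together with an arbitrary order
  on the rest, giving |A| * P(|A| - 1) possibilities (\<open>card_topped_orders\<close>). Summing
  over partitions gives the formula; singleton blocks contribute the factor 1.\<close>

definition partial_orders :: "'a set \<Rightarrow> 'a rel set" where
  "partial_orders A = {r. partial_order_on A r}"

definition topped_orders :: "'a set \<Rightarrow> 'a rel set" where
  "topped_orders A = {r \<in> partial_orders A. \<exists>m\<in>A. \<forall>x\<in>A. (x, m) \<in> r}"

text \<open>The carrier is not an argument; for a reflexive \<open>r\<close> the condition
  \<open>(m, m) \<in> r\<close> puts \<open>m\<close> into it.\<close>

definition maximal_elems :: "'a rel \<Rightarrow> 'a set" where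
  "maximal_elems r = {m. (m, m) \<in> r \<and> (\<forall>y. (m, y) \<in> r \<longrightarrow> y = m)}"

definition unique_maximal :: "'a set \<Rightarrow> 'a rel \<Rightarrow> bool" where
  "unique_maximal A r \<longleftrightarrow> (\<forall>x\<in>A. \<exists>!m. (x, m) \<in> r \<and> m \<in> maximal_elems r)"

lemma partial_orders_iff:
  "r \<in> partial_orders A \<longleftrightarrow>
     r \<subseteq> A \<times> A \<and> (\<forall>x\<in>A. (x, x) \<in> r) \<and> (\<forall>x y z. (x, y) \<in> r \<longrightarrow> (y, z) \<in> r \<longrightarrow> (x, z) \<in> r) \<and>
     (\<forall>x y. (x, y) \<in> r \<longrightarrow> (y, x) \<in> r \<longrightarrow> x = y)"
  by (auto simp: partial_orders_def partial_order_on_def preorder_on_def refl_on_def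
      trans_def antisym_def)

lemma finite_partial_orders:
  assumes "finite A"
  shows "finite (partial_orders A)"
proof (rule finite_subset)
  show "partial_orders A \<subseteq> Pow (A \<times> A)"
    by (auto simp: partial_orders_iff)
qed (use assms in simp)

lemma finite_topped_orders: "finite A \<Longrightarrow> finite (topped_orders A)"
  by (simp add: topped_orders_def finite_partial_orders)

section \<open>Counting partial orders and orders with a greatest element\<close>

lemma partial_orders_image:
  assumes "inj_on f A" and r: "r \<in> partial_orders A"
  shows "map_prod f f ` r \<in> partial_orders (f ` A)"
proof -
  have mem: "(f x, f y) \<in> map_prod f f ` r \<longleftrightarrow> (x, y) \<in> r" if "x \<in> A" "y \<in> A" for x y
  proof
    assume "(f x, f y) \<in> map_prod f f ` r"
    then obtain u v where "(u, v) \<in> r" "f x = f u" "f y = f v" by auto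
    moreover from this have "u \<in> A" "v \<in> A"
      using r by (auto simp: partial_orders_iff)
    ultimately show "(x, y) \<in> r"
      using assms(1) that by (auto dest: inj_onD)
  qed (auto simp: map_prod_def)
  have sub: "map_prod f f ` r \<subseteq> f ` A \<times> f ` A"
    using r by (auto simp: partial_orders_iff)
  show ?thesis
    unfolding partial_orders_iff
  proof (intro conjI allI impI ballI sub)
    fix x assume "x \<in> f ` A"
    then show "(x, x) \<in> map_prod f f ` r"
      using mem r by (auto simp: partial_orders_iff)
  next
    fix x y z assume xy: "(x, y) \<in> map_prod f f ` r" and yz: "(y, z) \<in> map_prod f f ` r"
    then obtain a b c where "a \<in> A" "b \<in> A" "c \<in> A" "x = f a" "y = f b" "z = f c"
      using sub by blast
    then show "(x, z) \<in> map_prod f f ` r"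
      using xy yz mem r unfolding partial_orders_iff by metis
  next
    fix x y assume xy: "(x, y) \<in> map_prod f f ` r" and yx: "(y, x) \<in> map_prod f f ` r"
    then obtain a b where "a \<in> A" "b \<in> A" "x = f a" "y = f b"
      using sub by blast
    then show "x = y"
      using xy yx mem r unfolding partial_orders_iff by metis
  qed
qed

text \<open>Transport along an injection is itself injective on relations. Applied to a bijection
  and to its inverse, the inequality becomes equality, so the count depends on the size of the
  carrier only.\<close>

lemma card_partial_orders_le:
  assumes "inj_on f A" "finite A"
  shows "card (partial_orders A) \<le> card (partial_orders (f ` A))"
proof (rule card_inj_on_le)
  have "inj_on (\<lambda>r. map_prod f f ` r) (Pow (A \<times> A))"
    using assms(1) by (intro inj_on_image_Pow map_prod_inj_on)
  moreover have "partial_orders A \<subseteq> Pow (A \<times> A)"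
    by (auto simp: partial_orders_iff)
  ultimately show "inj_on (\<lambda>r. map_prod f f ` r) (partial_orders A)"
    by (rule inj_on_subset)
qed (use assms in \<open>auto intro: partial_orders_image finite_partial_orders\<close>)

lemma card_partial_orders:
  assumes "finite A"
  shows "card (partial_orders A) = num_partial_orders (card A)"
proof -
  obtain f where f: "bij_betw f A {1..card A}"
    using assms finite_same_card_bij[of A "{1..card A}"] by auto
  obtain g where g: "bij_betw g {1..card A} A"
    using f bij_betw_inv by blast
  have "card (partial_orders A) = card (partial_orders {1..card A})"
    using card_partial_orders_le[of f A] card_partial_orders_le[of g "{1..card A}"] f g assms
    by (simp add: bij_betw_def)
  then show ?thesis
    by (simp add: num_partial_orders_def partial_orders_def)
qed

text \<open>Deleting the greatest element leaves an arbitrary order on the remaining elements, and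
  adjoining a new top undoes this.\<close>

lemma card_topped_orders:
  assumes fin: "finite A"
  shows "card (topped_orders A) = card A * num_partial_orders (card A - 1)"
proof -
  let ?f = "\<lambda>(m, s). s \<union> A \<times> {m}"
  let ?D = "SIGMA m:A. partial_orders (A - {m})"
  have "bij_betw ?f ?D (topped_orders A)"
  proof (rule bij_betw_imageI)
    show "inj_on ?f ?D"
    proof (rule inj_onI, clarify)
      fix m s m' s'
      assume m: "m \<in> A" "m' \<in> A" and s: "s \<in> partial_orders (A - {m})" "s' \<in> partial_orders (A - {m'})"
        and eq: "s \<union> A \<times> {m} = s' \<union> A \<times> {m'}"
      have "m = m'"
      \<comment> \<open>In the left relation nothing but \<open>m\<close> lies above
        \<open>m\<close>, whereas \<open>m'\<close> lies above everything in the right one.\<close>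
      proof (rule ccontr)
        assume "m \<noteq> m'"
        then have "(m, m') \<notin> s \<union> A \<times> {m}"
          using s(1) by (auto simp: partial_orders_iff)
        then show False using eq m by auto
      qed
      \<comment> \<open>Since \<open>s\<close> lives on \<open>A - {m}\<close>, dropping all pairs
        that end in \<open>m\<close> recovers it.\<close>
      moreover have "s = (s \<union> A \<times> {m}) - UNIV \<times> {m}" "s' = (s' \<union> A \<times> {m'}) - UNIV \<times> {m'}"
        using s by (auto simp: partial_orders_iff)
      ultimately show "m = m' \<and> s = s'"
        using eq by metis
    qed
    show "?f ` ?D = topped_orders A"
    proof (intro equalityI subsetI)
      fix r assume "r \<in> ?f ` ?D"
      then obtain m s where m: "m \<in> A" and s: "s \<in> partial_orders (A - {m})"
        and r: "r = s \<union> A \<times> {m}" by auto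
      have "r \<in> partial_orders A"
        using m s unfolding r partial_orders_iff by blast
      then show "r \<in> topped_orders A"
        using m by (auto simp: topped_orders_def r)
    next
      fix r assume r: "r \<in> topped_orders A"
      then obtain m where m: "m \<in> A" "\<forall>x\<in>A. (x, m) \<in> r" and po: "r \<in> partial_orders A"
        by (auto simp: topped_orders_def)
      let ?s = "r - UNIV \<times> {m}"
      have "r = ?s \<union> A \<times> {m}"
        using m po by (auto simp: partial_orders_iff)
      moreover have "?s \<in> partial_orders (A - {m})"
      proof -
        \<comment> \<open>By antisymmetry nothing lies above the top, so \<open>m\<close> does not
          start a pair of \<open>?s\<close> either.\<close>
        have "y = m" if "(m, y) \<in> r" for y
          using that m po unfolding partial_orders_iff by blast
        then show ?thesis
          using po unfolding partial_orders_iff by auto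
      qed
      ultimately show "r \<in> ?f ` ?D"
        using m(1) by (intro image_eqI[where x = "(m, ?s)"]) auto
    qed
  qed
  then have "card (topped_orders A) = card ?D"
    by (simp add: bij_betw_same_card)
  also have "\<dots> = (\<Sum>m\<in>A. num_partial_orders (card A - 1))"
    using fin by (simp add: finite_partial_orders card_partial_orders)
  finally show ?thesis by simp
qed

text \<open>The strict part of a finite order is acyclic, so its converse is well-founded; a minimal
  element, for that converse, of the set above \<open>x\<close> is maximal for
  \<open>r\<close>.\<close>

lemma ex_maximal_above:
  assumes r: "r \<in> partial_orders A" and "finite A" "x \<in> A"
  shows "\<exists>m. (x, m) \<in> r \<and> m \<in> maximal_elems r"
proof -
  have "finite r"
    using r assms(2) by (auto simp: partial_orders_iff intro: finite_subset)
  moreover have "acyclic (r - Id)"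
    using r partial_order_on_acyclic by (auto simp: partial_orders_def)
  ultimately have "wf ((r - Id)\<inverse>)"
    by (intro finite_acyclic_wf_converse) auto
  moreover have "x \<in> {y. (x, y) \<in> r}"
    using r assms(3) by (auto simp: partial_orders_iff)
  ultimately obtain m where "m \<in> {y. (x, y) \<in> r}"
    "\<And>y. (y, m) \<in> (r - Id)\<inverse> \<Longrightarrow> y \<notin> {y. (x, y) \<in> r}"
    by (rule wfE_min) blast
  then have m: "(x, m) \<in> r" "\<And>y. (m, y) \<in> r \<Longrightarrow> y \<noteq> m \<Longrightarrow> (x, y) \<notin> r"
    by auto
  have "m \<in> maximal_elems r"
    using m r unfolding maximal_elems_def partial_orders_iff by blast
  with m(1) show ?thesis by blast
qed

section \<open>Splitting an order into blocks below its maximal elements\<close>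

lemma maximal_elem_above_unique:
  assumes "unique_maximal A r" "x \<in> A" "(x, m) \<in> r" "m \<in> maximal_elems r"
    "(x, m') \<in> r" "m' \<in> maximal_elems r"
  shows "m = m'"
  using assms by (auto simp: unique_maximal_def)

text \<open>Blocks are disjoint, so no pair crosses between them and the order axioms hold
  blockwise. The maximal elements are the tops of the blocks, and each block is the principal
  down-set of its top. The last two conclusions recover \<open>P\<close> and \<open>g\<close> from
  \<open>r\<close>, which makes gluing injective.\<close>

lemma unique_maximal_glue:
  assumes P: "partition_on S P" and g: "g \<in> (\<Pi>\<^sub>E A\<in>P. topped_orders A)"
  defines "r \<equiv> \<Union>A\<in>P. g A"
  shows "r \<in> partial_orders S" and "unique_maximal S r"
    and "P = {r\<inverse> `` {m} | m. m \<in> maximal_elems r}"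
    and "\<And>A. A \<in> P \<Longrightarrow> g A = r \<inter> A \<times> A"
proof -
  have po: "g A \<in> partial_orders A" and top: "\<exists>m\<in>A. \<forall>x\<in>A. (x, m) \<in> g A" if "A \<in> P" for A
    using PiE_mem[OF g that] by (auto simp: topped_orders_def)
  have sub: "g A \<subseteq> A \<times> A" if "A \<in> P" for A
    using po[OF that] by (simp add: partial_orders_iff)
  have same: "A = B" if "A \<in> P" "B \<in> P" "x \<in> A" "x \<in> B" for A B x
    using partition_onD2[OF P] that by (auto simp: disjoint_def)
  have S: "S = \<Union>P" using P by (rule partition_onD1)
  have mem: "(x, y) \<in> r \<longleftrightarrow> (x, y) \<in> g A" if "A \<in> P" "x \<in> A \<or> y \<in> A" for A x y
  proof
    assume "(x, y) \<in> r"
    then obtain B where B: "B \<in> P" "(x, y) \<in> g B" by (auto simp: r_def)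
    then have "x \<in> B" "y \<in> B" using sub by auto
    then have "B = A" using that B(1) same by blast
    with B show "(x, y) \<in> g A" by simp
  qed (use that in \<open>auto simp: r_def\<close>)
  show gA: "g A = r \<inter> A \<times> A" if "A \<in> P" for A
    using mem[OF that] sub[OF that] by auto
  have block: "\<exists>A\<in>P. x \<in> A \<and> y \<in> A \<and> (x, y) \<in> g A" if xy: "(x, y) \<in> r" for x y
  proof -
    obtain A where "A \<in> P" "(x, y) \<in> g A" using xy by (auto simp: r_def)
    then show ?thesis using sub by blast
  qed
  show rpo: "r \<in> partial_orders S"
    unfolding partial_orders_iff
  proof (intro conjI allI impI ballI)
    show "r \<subseteq> S \<times> S"
    proof (rule subrelI)
      fix x y assume "(x, y) \<in> r"
      from block[OF this] show "(x, y) \<in> S \<times> S" unfolding S by blast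
    qed
    show "(x, x) \<in> r" if "x \<in> S" for x
      using that po mem unfolding S partial_orders_iff by blast
    show "(x, z) \<in> r" if xy: "(x, y) \<in> r" and yz: "(y, z) \<in> r" for x y z
    proof -
      obtain A where A: "A \<in> P" "x \<in> A" "y \<in> A" "(x, y) \<in> g A" using block xy by blast
      moreover have "(y, z) \<in> g A" using mem A yz by blast
      ultimately have "(x, z) \<in> g A" using po[OF A(1)] unfolding partial_orders_iff by blast
      then show ?thesis using mem A by blast
    qed
    show "x = y" if xy: "(x, y) \<in> r" and yx: "(y, x) \<in> r" for x y
    proof -
      obtain A where A: "A \<in> P" "x \<in> A" "y \<in> A" "(x, y) \<in> g A" using block xy by blast
      moreover have "(y, x) \<in> g A" using mem A yx by blast
      ultimately show ?thesis using po[OF A(1)] unfolding partial_orders_iff by blast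
    qed
  qed
  \<comment> \<open>\<open>t A\<close> is the top of block \<open>A\<close>; these tops turn out to
    be exactly the maximal elements of \<open>r\<close>.\<close>
  obtain t where t: "\<And>A. A \<in> P \<Longrightarrow> t A \<in> A" "\<And>A x. A \<in> P \<Longrightarrow> x \<in> A \<Longrightarrow> (x, t A) \<in> g A"
    using top by metis
  have t_max: "t A \<in> maximal_elems r" if A: "A \<in> P" for A
  proof -
    have "y = t A" if "(t A, y) \<in> r" for y
    proof -
      have "(t A, y) \<in> g A" using mem A that t by blast
      moreover from this have "(y, t A) \<in> g A" using sub[OF A] t A by blast
      ultimately show ?thesis using po[OF A] unfolding partial_orders_iff by blast
    qed
    moreover have "(t A, t A) \<in> r" using mem A t by blast
    ultimately show ?thesis by (simp add: maximal_elems_def)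
  qed
  have max_t: "m = t A" if "A \<in> P" "x \<in> A" "(x, m) \<in> r" "m \<in> maximal_elems r" for A x m
  proof -
    have "m \<in> A" using that mem sub by blast
    then have "(m, t A) \<in> r" using that(1) t mem by blast
    then show ?thesis using that(4) by (auto simp: maximal_elems_def)
  qed
  show "unique_maximal S r"
    unfolding unique_maximal_def
  proof
    fix x assume "x \<in> S"
    then obtain A where A: "A \<in> P" "x \<in> A" using S by blast
    show "\<exists>!m. (x, m) \<in> r \<and> m \<in> maximal_elems r"
    proof (rule ex1I[of _ "t A"])
      show "(x, t A) \<in> r \<and> t A \<in> maximal_elems r" using A t mem t_max by blast
    qed (use max_t A in blast)
  qed
  have down: "r\<inverse> `` {t A} = A" if A: "A \<in> P" for A
    using mem[OF A] t[OF A] sub[OF A] by blast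
  have t_ex: "\<exists>A\<in>P. m = t A" if "m \<in> maximal_elems r" for m
  proof -
    have mm: "(m, m) \<in> r" using that by (simp add: maximal_elems_def)
    then obtain A where "A \<in> P" "m \<in> A" using block by blast
    then show ?thesis using max_t mm that by blast
  qed
  show "P = {r\<inverse> `` {m} | m. m \<in> maximal_elems r}"
  proof (intro equalityI subsetI)
    fix A assume "A \<in> P"
    then show "A \<in> {r\<inverse> `` {m} | m. m \<in> maximal_elems r}"
      using down t_max by (intro CollectI exI[of _ "t A"]) simp
  next
    fix B assume "B \<in> {r\<inverse> `` {m} | m. m \<in> maximal_elems r}"
    then obtain m where "B = r\<inverse> `` {m}" "m \<in> maximal_elems r" by blast
    moreover from this obtain A where "A \<in> P" "m = t A" using t_ex by blast
    ultimately show "B \<in> P" using down by simp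
  qed
qed

text \<open>Inverse of gluing. Existence of a maximal element above each point makes the principal
  down-sets cover \<open>S\<close>; uniqueness makes them disjoint. The \<open>restrict\<close>
  fixes the value of \<open>g\<close> outside \<open>P\<close>, as the extensional product
  demands.\<close>

lemma unique_maximal_split:
  assumes r: "r \<in> partial_orders S" and u: "unique_maximal S r"
  defines "P \<equiv> {r\<inverse> `` {m} | m. m \<in> maximal_elems r}"
  defines "g \<equiv> restrict (\<lambda>A. r \<inter> A \<times> A) P"
  shows "partition_on S P" and "g \<in> (\<Pi>\<^sub>E A\<in>P. topped_orders A)" and "r = (\<Union>A\<in>P. g A)"
proof -
  have sub: "r \<subseteq> S \<times> S"
    and trans: "\<And>x y z. (x, y) \<in> r \<Longrightarrow> (y, z) \<in> r \<Longrightarrow> (x, z) \<in> r"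
    using r unfolding partial_orders_iff by blast+
  have ex: "\<exists>m. (x, m) \<in> r \<and> m \<in> maximal_elems r" if "x \<in> S" for x
    using u that by (auto simp: unique_maximal_def)
  have uniq: "m = m'" if "(x, m) \<in> r" "m \<in> maximal_elems r" "(x, m') \<in> r" "m' \<in> maximal_elems r"
    for x m m'
    using maximal_elem_above_unique[OF u] that sub by blast
  show "partition_on S P"
  proof (rule partition_onI)
    show "\<Union>P = S" using ex sub unfolding P_def by blast
    show "disjnt p q" if "p \<in> P" "q \<in> P" "p \<noteq> q" for p q
      using that uniq unfolding P_def disjnt_def by blast
    show "{} \<notin> P" unfolding P_def maximal_elems_def by blast
  qed
  have "r \<inter> A \<times> A \<in> topped_orders A" if A: "A \<in> P" for A
  proof -
    obtain m where m: "A = r\<inverse> `` {m}" "m \<in> maximal_elems r" using A unfolding P_def by blast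
    have "A \<subseteq> S" using sub m by blast
    then have "r \<inter> A \<times> A \<in> partial_orders A"
      using r unfolding partial_orders_iff by blast
    moreover have "m \<in> A" using m by (auto simp: maximal_elems_def)
    moreover have "\<forall>x\<in>A. (x, m) \<in> r \<inter> A \<times> A" using m(1) \<open>m \<in> A\<close> by blast
    ultimately show ?thesis by (auto simp: topped_orders_def)
  qed
  then show "g \<in> (\<Pi>\<^sub>E A\<in>P. topped_orders A)" by (auto simp: g_def)
  have block: "\<exists>A\<in>P. x \<in> A \<and> y \<in> A" if xy: "(x, y) \<in> r" for x y
  proof -
    \<comment> \<open>A maximal element above \<open>y\<close> is also above \<open>x\<close>, so
      both lie in one block.\<close>
    obtain m where m: "(y, m) \<in> r" "m \<in> maximal_elems r" using ex xy sub by blast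
    then have "(x, m) \<in> r" using trans xy by blast
    moreover have "r\<inverse> `` {m} \<in> P" using m(2) unfolding P_def by blast
    ultimately show ?thesis using m(1) by (intro bexI[of _ "r\<inverse> `` {m}"]) auto
  qed
  have "r = (\<Union>A\<in>P. r \<inter> A \<times> A)"
  proof
    show "r \<subseteq> (\<Union>A\<in>P. r \<inter> A \<times> A)"
    proof (rule subrelI)
      fix x y assume "(x, y) \<in> r"
      with block[OF this] show "(x, y) \<in> (\<Union>A\<in>P. r \<inter> A \<times> A)" by auto
    qed
  qed auto
  then show "r = (\<Union>A\<in>P. g A)" by (simp add: g_def)
qed

text \<open>Gluing is a bijection from pairs of a partition and a family of topped block orders; for
  a fixed partition the families form a product set.\<close>

lemma card_unique_maximal_orders:
  assumes fin: "finite S"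
  shows "card {r \<in> partial_orders S. unique_maximal S r} =
    (\<Sum>P | partition_on S P. \<Prod>A\<in>P. card (topped_orders A))"
proof -
  let ?D = "SIGMA P:{P. partition_on S P}. \<Pi>\<^sub>E A\<in>P. topped_orders A"
  let ?f = "\<lambda>(P, g). \<Union>A\<in>P. g A"
  have "bij_betw ?f ?D {r \<in> partial_orders S. unique_maximal S r}"
  proof (rule bij_betw_imageI)
    show "inj_on ?f ?D"
    proof (rule inj_onI, clarify)
      fix P g P' g'
      assume P: "partition_on S P" "partition_on S P'"
        and g: "g \<in> (\<Pi>\<^sub>E A\<in>P. topped_orders A)" "g' \<in> (\<Pi>\<^sub>E A\<in>P'. topped_orders A)"
        and eq: "(\<Union>A\<in>P. g A) = (\<Union>A\<in>P'. g' A)"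
      have PP': "P = P'"
        using unique_maximal_glue(3)[OF P(1) g(1)] unique_maximal_glue(3)[OF P(2) g(2)] eq by simp
      have "g = g'"
      proof (rule PiE_ext)
        show "g \<in> (\<Pi>\<^sub>E A\<in>P. topped_orders A)" by (fact g)
        show "g' \<in> (\<Pi>\<^sub>E A\<in>P. topped_orders A)" using g PP' by simp
        show "g A = g' A" if "A \<in> P" for A
          using unique_maximal_glue(4)[OF P(1) g(1), of A] unique_maximal_glue(4)[OF P(2) g(2), of A]
            that PP' eq by simp
      qed
      with PP' show "P = P' \<and> g = g'" by simp
    qed
    show "?f ` ?D = {r \<in> partial_orders S. unique_maximal S r}"
    proof (intro equalityI subsetI)
      fix r assume "r \<in> ?f ` ?D"
      then show "r \<in> {r \<in> partial_orders S. unique_maximal S r}"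
        using unique_maximal_glue(1,2) by fastforce
    next
      fix r assume "r \<in> {r \<in> partial_orders S. unique_maximal S r}"
      then have "r \<in> partial_orders S" "unique_maximal S r" by auto
      note split = unique_maximal_split[OF this]
      \<comment> \<open>The witness pair stays schematic until \<open>split(3)\<close> instantiates
        it with the partition and the restricted family.\<close>
      show "r \<in> ?f ` ?D"
        by (rule image_eqI[where x = "(_, _)"], unfold split_conv, rule split(3))
          (intro SigmaI CollectI split(1,2))
    qed
  qed
  then have "card {r \<in> partial_orders S. unique_maximal S r} = card ?D"
    by (simp add: bij_betw_same_card)
  also have "\<dots> = (\<Sum>P | partition_on S P. card (\<Pi>\<^sub>E A\<in>P. topped_orders A))"
  proof (rule card_SigmaI)
    show "finite {P. partition_on S P}" by (rule finitely_many_partition_on[OF fin])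
    have "finite (\<Pi>\<^sub>E A\<in>P. topped_orders A)" if P: "partition_on S P" for P
    proof (rule finite_PiE)
      show "finite P" using finite_elements[OF fin P] .
      show "finite (topped_orders A)" if "A \<in> P" for A
        using fin partition_onD1[OF P] that by (intro finite_topped_orders) (auto intro: finite_subset)
    qed
    then show "\<forall>P\<in>{P. partition_on S P}. finite (\<Pi>\<^sub>E A\<in>P. topped_orders A)" by blast
  qed
  also have "\<dots> = (\<Sum>P | partition_on S P. \<Prod>A\<in>P. card (topped_orders A))"
    using finite_elements[OF fin] by (intro sum.cong) (auto simp: card_PiE)
  finally show ?thesis .
qed

subsection \<open>The topology of down-sets\<close>

text \<open>The Alexandrov topology of the order, in the convention where down-sets rather than
  up-sets are open.\<close>

definition down_sets :: "'a set \<Rightarrow> 'a rel \<Rightarrow> 'a topology" where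
  "down_sets A r = topology (\<lambda>U. U \<subseteq> A \<and> r\<inverse> `` U \<subseteq> U)"

lemma openin_down_sets: "openin (down_sets A r) U \<longleftrightarrow> U \<subseteq> A \<and> r\<inverse> `` U \<subseteq> U"
proof -
  have "istopology (\<lambda>U. U \<subseteq> A \<and> r\<inverse> `` U \<subseteq> U)"
    unfolding istopology_def by blast
  then show ?thesis by (simp add: down_sets_def)
qed

lemma topspace_down_sets:
  assumes "r \<in> partial_orders A"
  shows "topspace (down_sets A r) = A"
proof
  have "openin (down_sets A r) A"
    using assms unfolding openin_down_sets partial_orders_iff by blast
  then show "A \<subseteq> topspace (down_sets A r)" by (rule openin_subset)
qed (auto simp: topspace_def openin_down_sets)

lemma openin_down_closure:
  assumes "r \<in> partial_orders A"
  shows "openin (down_sets A r) (r\<inverse> `` {y})"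
  using assms unfolding openin_down_sets partial_orders_iff by blast

text \<open>The specialization order, oriented to match open down-sets: \<open>x\<close> is below
  \<open>y\<close> when \<open>y\<close> lies in the closure of \<open>x\<close>.\<close>

definition specialization :: "'a topology \<Rightarrow> 'a rel" where
  "specialization X = {(x, y) \<in> topspace X \<times> topspace X. \<forall>U. openin X U \<longrightarrow> y \<in> U \<longrightarrow> x \<in> U}"

text \<open>Reflexivity and transitivity hold in any space; the T0 axiom supplies
  antisymmetry.\<close>

lemma specialization_partial_orders:
  assumes "t0_space X"
  shows "specialization X \<in> partial_orders (topspace X)"
  unfolding partial_orders_iff
proof (intro conjI allI impI)
  fix x y assume xy: "(x, y) \<in> specialization X" "(y, x) \<in> specialization X"
  show "x = y"
  proof (rule ccontr)
    assume "x \<noteq> y"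
    moreover have "x \<in> topspace X" "y \<in> topspace X"
      using xy by (auto simp: specialization_def)
    ultimately obtain U where "openin X U" "(x \<notin> U) = (y \<in> U)"
      using assms unfolding t0_space_def by blast
    then show False using xy by (auto simp: specialization_def)
  qed
qed (auto simp: specialization_def)

lemma specialization_down_sets:
  assumes r: "r \<in> partial_orders A"
  shows "specialization (down_sets A r) = r"
proof
  show "specialization (down_sets A r) \<subseteq> r"
  proof clarify
    fix x y assume xy: "(x, y) \<in> specialization (down_sets A r)"
    then have "y \<in> A" by (simp add: specialization_def topspace_down_sets[OF r])
    then have "y \<in> r\<inverse> `` {y}" using r by (auto simp: partial_orders_iff)
    then have "x \<in> r\<inverse> `` {y}"
      using xy openin_down_closure[OF r, of y] unfolding specialization_def by blast
    then show "(x, y) \<in> r" by simp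
  qed
  show "r \<subseteq> specialization (down_sets A r)"
    using r by (auto simp: specialization_def topspace_down_sets[OF r] partial_orders_iff openin_down_sets)
qed

text \<open>Finiteness enters here: there are finitely many open sets, so each point has a smallest
  open neighbourhood, and a down-set is a union of such neighbourhoods.\<close>

lemma down_sets_specialization:
  assumes "finite (topspace X)"
  shows "down_sets (topspace X) (specialization X) = X"
  unfolding topology_eq
proof (intro allI iffI)
  fix U assume "openin X U"
  then show "openin (down_sets (topspace X) (specialization X)) U"
    using openin_subset by (auto simp: openin_down_sets specialization_def)
next
  fix U assume U: "openin (down_sets (topspace X) (specialization X)) U"
  then have UX: "U \<subseteq> topspace X" by (simp add: openin_down_sets)
  have finO: "finite {V. openin X V}"
    by (rule finite_subset[of _ "Pow (topspace X)"]) (use assms openin_subset in auto)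
  have "\<exists>V. openin X V \<and> y \<in> V \<and> V \<subseteq> U" if y: "y \<in> U" for y
  proof -
    \<comment> \<open>The smallest neighbourhood of \<open>y\<close>; its points are those below
      \<open>y\<close>.\<close>
    let ?V = "\<Inter>{V. openin X V \<and> y \<in> V}"
    have yX: "openin X (topspace X)" "y \<in> topspace X" using y UX by auto
    then have "openin X ?V"
      using finO by (intro openin_Inter) (auto intro: finite_subset)
    moreover have "?V \<subseteq> U"
    proof
      fix x assume x: "x \<in> ?V"
      then have "(x, y) \<in> specialization X" using yX by (auto simp: specialization_def)
      then show "x \<in> U" using U y by (auto simp: openin_down_sets)
    qed
    ultimately show ?thesis by blast
  qed
  then show "openin X U" using openin_subopen[of X U] by blast
qed

lemma t0_space_down_sets:
  assumes r: "r \<in> partial_orders A"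
  shows "t0_space (down_sets A r)"
  unfolding t0_space_def
proof (intro ballI impI, rule ccontr)
  fix x y assume xy: "x \<in> topspace (down_sets A r)" "y \<in> topspace (down_sets A r)" "x \<noteq> y"
    "\<not> (\<exists>U. openin (down_sets A r) U \<and> (x \<notin> U) = (y \<in> U))"
  then have "(x, y) \<in> specialization (down_sets A r)" "(y, x) \<in> specialization (down_sets A r)"
    by (auto simp: specialization_def)
  then show False
    using r xy unfolding specialization_down_sets[OF r] partial_orders_iff by blast
qed

lemma bij_betw_down_sets:
  assumes "finite A"
  shows "bij_betw (down_sets A) (partial_orders A) {X. topspace X = A \<and> t0_space X}"
proof (rule bij_betw_byWitness[where f' = specialization])
  show "\<forall>r\<in>partial_orders A. specialization (down_sets A r) = r"
    using specialization_down_sets by blast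
  show "\<forall>X\<in>{X. topspace X = A \<and> t0_space X}. down_sets A (specialization X) = X"
    using assms down_sets_specialization by blast
  show "down_sets A ` partial_orders A \<subseteq> {X. topspace X = A \<and> t0_space X}"
    using topspace_down_sets t0_space_down_sets by blast
  show "specialization ` {X. topspace X = A \<and> t0_space X} \<subseteq> partial_orders A"
    using specialization_partial_orders by blast
qed

subsection \<open>Covering dimension\<close>

lemma cover_order_le_iff:
  assumes "finite \<A>"
  shows "cover_order \<A> \<le> m \<longleftrightarrow> (\<forall>\<S>\<subseteq>\<A>. \<Inter>\<S> \<noteq> {} \<longrightarrow> int (card \<S>) - 1 \<le> m)"
proof -
  let ?M = "{int (card \<S>) - 1 | \<S>. \<S> \<subseteq> \<A> \<and> \<Inter>\<S> \<noteq> {}}"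
  have "finite ?M"
    by (rule finite_subset[of _ "(\<lambda>\<S>. int (card \<S>) - 1) ` Pow \<A>"]) (use assms in auto)
  moreover have "?M \<noteq> {}" by (auto intro: exI[of _ "{}"])
  ultimately show ?thesis unfolding cover_order_def by (subst Max_le_iff) blast+
qed

text \<open>Order at most 0 means that a subfamily with a common point has at most one member;
  two-element subfamilies already test this.\<close>

lemma cover_order_le_0_iff:
  assumes "finite \<A>"
  shows "cover_order \<A> \<le> 0 \<longleftrightarrow> disjoint \<A>"
proof
  assume le: "cover_order \<A> \<le> 0"
  show "disjoint \<A>"
  proof (rule disjointI)
    fix U V assume UV: "U \<in> \<A>" "V \<in> \<A>" "U \<noteq> V"
    have "{U, V} \<subseteq> \<A> \<longrightarrow> \<Inter>{U, V} \<noteq> {} \<longrightarrow> int (card {U, V}) - 1 \<le> 0"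
      using le unfolding cover_order_le_iff[OF assms] by (rule spec)
    then show "U \<inter> V = {}" using UV by auto
  qed
next
  assume dis: "disjoint \<A>"
  show "cover_order \<A> \<le> 0"
    unfolding cover_order_le_iff[OF assms]
  proof (intro allI impI)
    fix \<S> assume \<S>: "\<S> \<subseteq> \<A>" "\<Inter>\<S> \<noteq> {}"
    then obtain x where x: "\<And>U. U \<in> \<S> \<Longrightarrow> x \<in> U" by blast
    have "U = V" if "U \<in> \<S>" "V \<in> \<S>" for U V
    proof (rule ccontr)
      assume "U \<noteq> V"
      then have "U \<inter> V = {}" using disjointD[OF dis] that \<S>(1) by auto
      then show False using x that by auto
    qed
    moreover have "finite \<S>" using \<S>(1) assms by (rule finite_subset)
    ultimately have "card \<S> \<le> Suc 0" by (simp add: card_le_Suc0_iff_eq)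
    then show "int (card \<S>) - 1 \<le> 0" by simp
  qed
qed

text \<open>Any cover of a nonempty space has a nonempty member \<open>U\<close>, and the subfamily
  \<open>{U}\<close> forces order at least 0.\<close>

lemma not_covering_dim_le_minus_one:
  assumes "topspace X \<noteq> {}"
  shows "\<not> covering_dim_le X (-1)"
proof
  assume "covering_dim_le X (-1)"
  moreover have "finite_open_cover X {topspace X}" by (simp add: finite_open_cover_def)
  ultimately obtain \<A> where \<A>: "finite_open_cover X \<A>" "cover_order \<A> \<le> -1"
    unfolding covering_dim_le_def by blast
  then have fin: "finite \<A>" and un: "\<Union>\<A> = topspace X" by (auto simp: finite_open_cover_def)
  obtain U where U: "U \<in> \<A>" "U \<noteq> {}" using assms un by blast
  have "int (card {U}) - 1 \<le> -1"
    using \<A>(2) U unfolding cover_order_le_iff[OF fin] by (elim allE[of _ "{U}"]) simp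
  then show False by simp
qed

text \<open>Every element has a maximal element above it. The finest open cover consists of the down-sets
  of the maximal elements, so the space is zero-dimensional iff these down-sets are disjoint.\<close>

lemma covering_dim_le_0_down_sets_iff:
  assumes r: "r \<in> partial_orders A" and fin: "finite A"
  shows "covering_dim_le (down_sets A r) 0 \<longleftrightarrow> unique_maximal A r"
proof -
  let ?X = "down_sets A r"
  have sub: "r \<subseteq> A \<times> A" and refl: "\<And>x. x \<in> A \<Longrightarrow> (x, x) \<in> r"
    using r unfolding partial_orders_iff by blast+
  show ?thesis
  proof
    assume dim: "covering_dim_le ?X 0"
    \<comment> \<open>The hypothesis is tested on the cover by all principal down-sets.\<close>
    let ?B = "(\<lambda>y. r\<inverse> `` {y}) ` A"
    have "\<Union>?B = A" using sub refl by blast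
    then have "finite_open_cover ?X ?B"
      using fin openin_down_closure[OF r] topspace_down_sets[OF r] by (auto simp: finite_open_cover_def)
    then obtain \<A> where \<A>: "finite_open_cover ?X \<A>" "finer_cover \<A> ?B" "cover_order \<A> \<le> 0"
      using dim unfolding covering_dim_le_def by blast
    then have un: "\<Union>\<A> = A" and op: "\<And>U. U \<in> \<A> \<Longrightarrow> openin ?X U" and dis: "disjoint \<A>"
      by (auto simp: finite_open_cover_def topspace_down_sets[OF r] cover_order_le_0_iff)
    have "m = m'" if m: "(x, m) \<in> r" "m \<in> maximal_elems r" "(x, m') \<in> r" "m' \<in> maximal_elems r"
      for x m m'
    proof -
      obtain U V where UV: "U \<in> \<A>" "m \<in> U" "V \<in> \<A>" "m' \<in> V"
        using m sub un by blast
      \<comment> \<open>\<open>U\<close> and \<open>V\<close> are down-sets sharing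
        \<open>x\<close>, so they coincide; as \<open>U\<close> lies below a single
        \<open>y\<close>, maximality gives \<open>m = y = m'\<close>.\<close>
      then have "x \<in> U \<inter> V" using op m unfolding openin_down_sets by blast
      then have "U = V" using disjointD[OF dis] UV by blast
      moreover obtain y where "U \<subseteq> r\<inverse> `` {y}"
        using \<A>(2) UV(1) by (auto simp: finer_cover_def)
      ultimately have "(m, y) \<in> r" "(m', y) \<in> r" using UV by auto
      then show ?thesis using m by (auto simp: maximal_elems_def)
    qed
    then show "unique_maximal A r"
      unfolding unique_maximal_def using ex_maximal_above[OF r fin] by (intro ballI ex_ex1I) auto
  next
    assume u: "unique_maximal A r"
    let ?A = "(\<lambda>m. r\<inverse> `` {m}) ` maximal_elems r"
    have "maximal_elems r \<subseteq> A" using sub by (auto simp: maximal_elems_def)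
    then have finA: "finite ?A" using fin finite_subset by blast
    have "\<Union>?A = A" using sub ex_maximal_above[OF r fin] by blast
    then have cov: "finite_open_cover ?X ?A"
      using finA openin_down_closure[OF r] topspace_down_sets[OF r] by (auto simp: finite_open_cover_def)
    have "disjoint ?A"
    proof (rule disjointI)
      fix U V assume UV: "U \<in> ?A" "V \<in> ?A" "U \<noteq> V"
      then obtain m m' where m: "U = r\<inverse> `` {m}" "m \<in> maximal_elems r"
        "V = r\<inverse> `` {m'}" "m' \<in> maximal_elems r" by blast
      have False if "x \<in> U \<inter> V" for x
      proof -
        have x: "(x, m) \<in> r" "(x, m') \<in> r" using that m by auto
        then have "m = m'"
          using maximal_elem_above_unique[OF u, of x m m'] sub m by blast
        then show False using UV(3) m by simp
      qed
      then show "U \<inter> V = {}" by blast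
    qed
    then have ord: "cover_order ?A \<le> 0" by (simp add: cover_order_le_0_iff[OF finA])
    show "covering_dim_le ?X 0"
      unfolding covering_dim_le_def
    proof (intro allI impI exI conjI)
      fix \<B> assume \<B>: "finite_open_cover ?X \<B>"
      show "finer_cover ?A \<B>"
        unfolding finer_cover_def
      proof clarify
        fix m assume "m \<in> maximal_elems r"
        then have "m \<in> A" using \<open>maximal_elems r \<subseteq> A\<close> by blast
        \<comment> \<open>An open set containing \<open>m\<close> contains its whole principal
          down-set, so \<open>?A\<close> refines every open cover.\<close>
        then obtain B where "B \<in> \<B>" "m \<in> B" "openin ?X B"
          using \<B> unfolding finite_open_cover_def topspace_down_sets[OF r] by blast
        then show "\<exists>B\<in>\<B>. r\<inverse> `` {m} \<subseteq> B"
          unfolding openin_down_sets by blast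
      qed
    qed (rule cov, rule ord)
  qed
qed

section \<open>From topologies to the counting formula\<close>

lemma card_zero_dim_T0_topologies:
  assumes "finite A" "A \<noteq> {}"
  shows "card {X. topspace X = A \<and> t0_space X \<and> covering_dim_zero X} =
    card {r \<in> partial_orders A. unique_maximal A r}"
proof -
  \<comment> \<open>Since \<open>A\<close> is nonempty, dimension 0 and dimension at most 0
    agree.\<close>
  have dim: "covering_dim_zero (down_sets A r) \<longleftrightarrow> unique_maximal A r" if "r \<in> partial_orders A" for r
    using covering_dim_le_0_down_sets_iff[OF that assms(1)]
      not_covering_dim_le_minus_one[of "down_sets A r"] topspace_down_sets[OF that] assms(2)
    by (simp add: covering_dim_zero_def)
  note bij = bij_betw_down_sets[OF assms(1)]
  have inj: "inj_on (down_sets A) {r \<in> partial_orders A. unique_maximal A r}"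
    by (rule inj_on_subset[OF bij_betw_imp_inj_on[OF bij]]) blast
  have "{X. topspace X = A \<and> t0_space X \<and> covering_dim_zero X} =
      {X \<in> down_sets A ` partial_orders A. covering_dim_zero X}"
    unfolding bij_betw_imp_surj_on[OF bij] by blast
  also have "\<dots> = down_sets A ` {r \<in> partial_orders A. unique_maximal A r}"
    using dim by blast
  finally show ?thesis using card_image[OF inj] by simp
qed

theorem theorem2:
  fixes n :: nat
  assumes "n \<ge> 1"
  shows "num_zero_dim_T0_topologies n =
    (\<Sum>\<P> | partition_on {1..n} \<P>.
       \<Prod>A | A \<in> \<P> \<and> card A > 1. card A * num_partial_orders (card A - 1))"
proof -
  \<comment> \<open>The empty relation is the only order on the empty set; this makes the factor of
    a singleton block equal to 1.\<close>
  have [simp]: "num_partial_orders 0 = 1"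
  proof -
    have "partial_orders {} = {{} :: nat rel}" by (auto simp: partial_orders_iff)
    then show ?thesis using card_partial_orders[of "{} :: nat set"] by simp
  qed
  have prod: "(\<Prod>A\<in>\<P>. card (topped_orders A)) =
      (\<Prod>A | A \<in> \<P> \<and> card A > 1. card A * num_partial_orders (card A - 1))"
    if \<P>: "partition_on {1..n} \<P>" for \<P>
  proof -
    have fin: "finite A" "A \<noteq> {}" if "A \<in> \<P>" for A
    proof -
      have "A \<subseteq> {1..n}" using partition_onD1[OF \<P>] that by blast
      then show "finite A" by (rule finite_subset) simp
      show "A \<noteq> {}" using partition_onD3[OF \<P>] that by blast
    qed
    have "(\<Prod>A\<in>\<P>. card (topped_orders A)) = (\<Prod>A\<in>\<P>. card A * num_partial_orders (card A - 1))"
      using fin by (intro prod.cong) (auto simp: card_topped_orders)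
    also have "\<dots> = (\<Prod>A | A \<in> \<P> \<and> card A > 1. card A * num_partial_orders (card A - 1))"
    \<comment> \<open>Blocks are nonempty, so those dropped are singletons with factor 1.\<close>
    proof (rule prod.mono_neutral_right)
      show "finite \<P>" by (rule finite_elements[OF _ \<P>]) simp
      show "\<forall>A\<in>\<P> - {A. A \<in> \<P> \<and> card A > 1}. card A * num_partial_orders (card A - 1) = 1"
      proof
        fix A assume "A \<in> \<P> - {A. A \<in> \<P> \<and> card A > 1}"
        then have "card A = 1" using fin[of A] card_gt_0_iff[of A] by auto
        then show "card A * num_partial_orders (card A - 1) = 1" by simp
      qed
    qed blast
    finally show ?thesis .
  qed
  have "num_zero_dim_T0_topologies n = card {r \<in> partial_orders {1..n}. unique_maximal {1..n} r}"
    using assms by (simp add: num_zero_dim_T0_topologies_def card_zero_dim_T0_topologies)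
  also have "\<dots> = (\<Sum>\<P> | partition_on {1..n} \<P>. \<Prod>A\<in>\<P>. card (topped_orders A))"
    by (simp add: card_unique_maximal_orders)
  also have "\<dots> = (\<Sum>\<P> | partition_on {1..n} \<P>.
       \<Prod>A | A \<in> \<P> \<and> card A > 1. card A * num_partial_orders (card A - 1))"
    by (intro sum.cong) (auto simp: prod)
  finally show ?thesis .
qed

end
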